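(* Let $(G,w_e)$ be a connected edge-weighted graph with $w_e:E(G)\to[0,\infty)$, and let $\{F_1,\ldots,F_r\}$ be a c-partition of $E(G)$. Then $$\widehat{W}_e(G,w_e)=\sum_{i=1}^r\Big(W(G/F_i,w^i)+\widehat{W}_e(G/F_i,w_e^i)+W_{ve}(G/F_i,w^i,w_e^i)\Big).$$
   Context: All graphs are finite and simple; $d_G(u,v)$ is the shortest-path distance between vertices. For a vertex $v$ and edge $e=xy$, $d_G(v,e)=\min\{d_G(v,x),d_G(v,y)\}$; for edges $e=xy$, $f=ab$, $d_G(e,f)=\min\{d_G(x,a),d_G(x,b),d_G(y,a),d_G(y,b)\}$. For a graph $H$ with weights $w:V(H)\to[0,\infty)$ and $w_e:E(H)\to[0,\infty)$: $W(H,w)=\frac12\sum_{u\in V(H)}\sum_{v\in V(H)}w(u)w(v)d_H(u,v)$, $\widehat{W}_e(H,w_e)=\frac12\sum_{e\in E(H)}\sum_{f\in E(H)}w_e(e)w_e(f)d_H(e,f)$, $W_{ve}(H,w,w_e)=\sum_{v\in V(H)}\sum_{e\in E(H)}w(v)w_e(e)d_H(v,e)$. Two edges $e=xy$, $f=ab$ of $G$ are in relation $\Theta$ if $d_G(x,a)+d_G(y,b)\neq d_G(x,b)+d_G(y,a)$; $\Theta^*$ is its transitive closure, whose equivalence classes form the $\Theta^*$-partition of $E(G)$. A partition $\{F_1,\ldots,F_r\}$ of $E(G)$ is a c-partition if every $\Theta^*$-class is contained in some $F_i$. For $E'\subseteq E(G)$, the quotient graph $G/E'$ has as vertices the connected components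 of $G\setminus E'$ (delete the edges of $E'$), two components $X,Y$ adjacent iff some vertex of $X$ is adjacent in $G$ to some vertex of $Y$; such an edge $XY$ of $G/E'$ is also identified with the set of edges of $G$ with one end in $X$ and the other in $Y$. The weights on $G/F_i$ are: for each vertex $X$ of $G/F_i$, $w^i(X)=\sum_{e\in E(X)}w_e(e)$ (sum of weights of edges of the component $X$); for each edge $XY$ of $G/F_i$, $w_e^i(XY)$ is the sum of $w_e(e)$ over all edges $e$ of $G$ with one end in $X$ and the other in $Y$. *)

theory Defs
  imports Complex_Main "HOL-Library.Disjoint_Sets"
begin

text \<open>An edge is the set of its two ends.\<close>

record 'a sgraph =
  verts :: "'a set"
  edges :: "'a set set"

definition finite_simple_graph :: "'a sgraph \<Rightarrow> bool" where
  "finite_simple_graph G \<longleftrightarrow>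
     finite (verts G) \<and> (\<forall>e\<in>edges G. e \<subseteq> verts G \<and> card e = 2)"

definition path_between :: "'a sgraph \<Rightarrow> 'a \<Rightarrow> 'a list \<Rightarrow> 'a \<Rightarrow> bool" where
  "path_between G u p v \<longleftrightarrow>
     p \<noteq> [] \<and> hd p = u \<and> last p = v \<and> distinct p \<and> set p \<subseteq> verts G \<and>
     successively (\<lambda>x y. {x, y} \<in> edges G) p"

definition connected_graph :: "'a sgraph \<Rightarrow> bool" where
  "connected_graph G \<longleftrightarrow>
     verts G \<noteq> {} \<and> (\<forall>u\<in>verts G. \<forall>v\<in>verts G. \<exists>p. path_between G u p v)"

text \<open>The value is unspecified if no path joins \<open>u\<close> and \<open>v\<close>. The notion is only used for
  connected graphs and for their quotients, which are connected as well.\<close>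

definition gdist :: "'a sgraph \<Rightarrow> 'a \<Rightarrow> 'a \<Rightarrow> nat" where
  "gdist G u v = (LEAST n. \<exists>p. path_between G u p v \<and> n = length p - 1)"

definition vedist :: "'a sgraph \<Rightarrow> 'a \<Rightarrow> 'a set \<Rightarrow> nat" where
  "vedist G v e = Min {gdist G v x | x. x \<in> e}"

definition eedist :: "'a sgraph \<Rightarrow> 'a set \<Rightarrow> 'a set \<Rightarrow> nat" where
  "eedist G e f = Min {gdist G x a | x a. x \<in> e \<and> a \<in> f}"

lemma vedist_edge: "vedist G v {x, y} = min (gdist G v x) (gdist G v y)"
proof -
  have "{gdist G v z | z. z \<in> {x, y}} = {gdist G v x, gdist G v y}" by auto
  then show ?thesis by (simp add: vedist_def)
qed

lemma eedist_edge:
  "eedist G {x, y} {a, b} =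
     Min {gdist G x a, gdist G x b, gdist G y a, gdist G y b}"
proof -
  have "{gdist G u c | u c. u \<in> {x, y} \<and> c \<in> {a, b}} =
      {gdist G x a, gdist G x b, gdist G y a, gdist G y b}" by auto
  then show ?thesis by (simp only: eedist_def)
qed

definition wiener :: "'a sgraph \<Rightarrow> ('a \<Rightarrow> real) \<Rightarrow> real" where
  "wiener H w =
     1/2 * (\<Sum>u\<in>verts H. \<Sum>v\<in>verts H. w u * w v * real (gdist H u v))"

definition edge_wiener :: "'a sgraph \<Rightarrow> ('a set \<Rightarrow> real) \<Rightarrow> real" where
  "edge_wiener H we =
     1/2 * (\<Sum>e\<in>edges H. \<Sum>f\<in>edges H. we e * we f * real (eedist H e f))"

definition vertex_edge_wiener ::
    "'a sgraph \<Rightarrow> ('a \<Rightarrow> real) \<Rightarrow> ('a set \<Rightarrow> real) \<Rightarrow> real" where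
  "vertex_edge_wiener H w we =
     (\<Sum>v\<in>verts H. \<Sum>e\<in>edges H. w v * we e * real (vedist H v e))"

text \<open>The inequality is invariant under swapping the ends of either edge, so it does not matter
  which naming of the ends witnesses the existential quantifier.\<close>

definition Theta :: "'a sgraph \<Rightarrow> ('a set \<times> 'a set) set" where
  "Theta G = {(e, f). e \<in> edges G \<and> f \<in> edges G \<and>
     (\<exists>x y a b. e = {x, y} \<and> f = {a, b} \<and>
        gdist G x a + gdist G y b \<noteq> gdist G x b + gdist G y a)}"

definition Theta_star :: "'a sgraph \<Rightarrow> ('a set \<times> 'a set) set" where
  "Theta_star G = (Theta G)\<^sup>+"

definition c_partition :: "'a sgraph \<Rightarrow> 'a set set set \<Rightarrow> bool" where
  "c_partition G P \<longleftrightarrow>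
     partition_on (edges G) P \<and> (\<forall>C\<in>edges G // Theta_star G. \<exists>F\<in>P. C \<subseteq> F)"

definition delete_edges :: "'a sgraph \<Rightarrow> 'a set set \<Rightarrow> 'a sgraph" where
  "delete_edges G F = \<lparr>verts = verts G, edges = edges G - F\<rparr>"

text \<open>A connected component is represented by its vertex set.\<close>

definition components :: "'a sgraph \<Rightarrow> 'a set set" where
  "components G = {{v \<in> verts G. \<exists>p. path_between G u p v} | u. u \<in> verts G}"

definition edges_between :: "'a sgraph \<Rightarrow> 'a set \<Rightarrow> 'a set \<Rightarrow> 'a set set" where
  "edges_between G X Y = {e \<in> edges G. \<exists>x\<in>X. \<exists>y\<in>Y. e = {x, y}}"

definition quotient_graph :: "'a sgraph \<Rightarrow> 'a set set \<Rightarrow> 'a set sgraph" where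
  "quotient_graph G F =
     \<lparr>verts = components (delete_edges G F),
      edges = {{X, Y} | X Y. X \<in> components (delete_edges G F) \<and>
                 Y \<in> components (delete_edges G F) \<and> X \<noteq> Y \<and>
                 (\<exists>x\<in>X. \<exists>y\<in>Y. {x, y} \<in> edges G)}\<rparr>"

text \<open>The edges of a component \<open>X\<close> are those of \<open>G\<close> without \<open>F\<close>, not those of the subgraph
  of \<open>G\<close> induced by \<open>X\<close>.\<close>

definition quotient_vertex_weight ::
    "'a sgraph \<Rightarrow> 'a set set \<Rightarrow> ('a set \<Rightarrow> real) \<Rightarrow> 'a set \<Rightarrow> real" where
  "quotient_vertex_weight G F we X =
     (\<Sum>e\<in>{e \<in> edges (delete_edges G F). e \<subseteq> X}. we e)"

definition quotient_edge_weight ::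
    "'a sgraph \<Rightarrow> ('a set \<Rightarrow> real) \<Rightarrow> 'a set set \<Rightarrow> real" where
  "quotient_edge_weight G we XY =
     (\<Sum>e\<in>{e. \<exists>X Y. XY = {X, Y} \<and> e \<in> edges_between G X Y}. we e)"

end

theory Submission
  imports Defs
begin

text \<open>
  Write \<open>\<ell>\<close> for the projection of \<open>G\<close> onto \<open>G/F\<close>.  Along a geodesic from \<open>u\<close> to \<open>v\<close> with edges
  \<open>x\<^sub>i y\<^sub>i\<close>, consider the potential \<open>z \<mapsto> \<Sum> (d(x\<^sub>i, z) - d(y\<^sub>i, z))\<close>, summed over the edges of
  the geodesic that lie in \<open>F\<close>.  If \<open>F\<close> is a union of \<open>\<Theta>\<^sup>*\<close>-classes, it is constant along edges
  outside \<open>F\<close>, and along an edge of \<open>F\<close> the full sum over the geodesic changes by the same amount;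
  the latter telescopes, so the change is at most 2.  As the potential grows by 2 for every edge of
  the geodesic in \<open>F\<close>, the distance of \<open>\<ell> u\<close> and \<open>\<ell> v\<close> in \<open>G/F\<close> is the number of these edges.
  Hence \<open>d(u, v)\<close> is the sum of the distances in the quotients.  This passes to distances of
  edges, since the ends of an edge are identified in all quotients but one, and the theorem follows
  by grouping the edges of \<open>G\<close> according to their image \<open>\<ell> ` e\<close>, which is a vertex or an edge
  of \<open>G/F\<close>.
\<close>

section \<open>Distances and walks\<close>

text \<open>Walks of length \<open>n\<close> are the pairs in \<open>adj G ^^ n\<close>. Vertices
  may repeat, so walks can be concatenated and projected to a quotient, which may destroy the
  distinctness required by \<open>path_between\<close>.\<close>

definition adj :: "'a sgraph \<Rightarrow> ('a \<times> 'a) set" where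
  "adj G = {(x, y). x \<in> verts G \<and> y \<in> verts G \<and> {x, y} \<in> edges G}"

lemma sym_adj: "sym (adj G)"
  by (auto simp: adj_def sym_def insert_commute)

lemma adj_rtrancl_commute: "(x, y) \<in> (adj G)\<^sup>* \<longleftrightarrow> (y, x) \<in> (adj G)\<^sup>*"
  using sym_rtrancl[OF sym_adj] by (metis symD)

lemma adj_rtrancl_verts: "(u, v) \<in> (adj G)\<^sup>* \<Longrightarrow> u \<in> verts G \<Longrightarrow> v \<in> verts G"
  by (induction rule: rtrancl_induct) (auto simp: adj_def)

lemma relpow_adj_verts: "(u, v) \<in> adj G ^^ n \<Longrightarrow> u \<in> verts G \<Longrightarrow> v \<in> verts G"
  using adj_rtrancl_verts relpow_imp_rtrancl by metis

section \<open>Paths, walks and the distance they define\<close>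

lemma path_between_relpow:
  "path_between G u p v \<Longrightarrow> (u, v) \<in> adj G ^^ (length p - 1)"
proof (induction p arbitrary: u)
  case Nil
  then show ?case by (simp add: path_between_def)
next
  case (Cons a p)
  show ?case
  proof (cases p)
    case Nil
    with Cons.prems show ?thesis by (auto simp: path_between_def)
  next
    case (Cons b q)
    with Cons.prems have "path_between G b p v" "(u, b) \<in> adj G"
      by (auto simp: path_between_def adj_def)
    with Cons.IH have "(b, v) \<in> adj G ^^ (length p - 1)" by blast
    with \<open>(u, b) \<in> adj G\<close> have "(u, v) \<in> adj G ^^ Suc (length p - 1)"
      by (rule relpow_Suc_I2)
    with Cons show ?thesis by simp
  qed
qed

text \<open>Only an upper bound on the length survives: when a step of the walk returns to a vertex
  already on the path, the path is cut off at that vertex instead of extended.\<close>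

lemma relpow_path_between:
  assumes "u \<in> verts G"
  shows "(u, v) \<in> adj G ^^ n \<Longrightarrow> \<exists>p. path_between G u p v \<and> length p - 1 \<le> n"
proof (induction n arbitrary: v)
  case 0
  with assms have "path_between G u [u] v" by (simp add: path_between_def)
  then show ?case by fastforce
next
  case (Suc n)
  then obtain w where w: "(u, w) \<in> adj G ^^ n" "(w, v) \<in> adj G" by auto
  with Suc.IH obtain p where p: "path_between G u p w" "length p - 1 \<le> n" by blast
  show ?case
  proof (cases "v \<in> set p")
    case True
    then obtain q r where qr: "p = (q @ [v]) @ r" by (auto dest: split_list)
    then have "successively (\<lambda>x y. {x, y} \<in> edges G) (q @ [v])"
      using p(1) unfolding path_between_def by (metis successively_append_iff)
    with p(1) qr have "path_between G u (q @ [v]) v"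
      by (cases q) (auto simp: path_between_def)
    moreover have "length (q @ [v]) - 1 \<le> Suc n" using p(2) qr by simp
    ultimately show ?thesis by blast
  next
    case False
    with p w have "path_between G u (p @ [v]) v"
      by (auto simp: path_between_def successively_append_iff adj_def)
    moreover have "length (p @ [v]) - 1 \<le> Suc n" using p(2) by simp
    ultimately show ?thesis by blast
  qed
qed

lemma path_between_iff_rtrancl:
  assumes "u \<in> verts G"
  shows "(\<exists>p. path_between G u p v) \<longleftrightarrow> (u, v) \<in> (adj G)\<^sup>*"
proof
  assume "\<exists>p. path_between G u p v"
  then show "(u, v) \<in> (adj G)\<^sup>*" using path_between_relpow relpow_imp_rtrancl by metis
next
  assume "(u, v) \<in> (adj G)\<^sup>*"
  then show "\<exists>p. path_between G u p v"
    using relpow_path_between[OF assms] rtrancl_imp_relpow by metis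
qed

lemma gdist_le:
  assumes "u \<in> verts G" "(u, v) \<in> adj G ^^ n"
  shows "gdist G u v \<le> n"
proof -
  obtain p where p: "path_between G u p v" "length p - 1 \<le> n"
    using relpow_path_between[OF assms] by blast
  have "gdist G u v \<le> length p - 1"
    unfolding gdist_def by (rule Least_le) (use p in blast)
  with p show ?thesis by simp
qed

text \<open>Reachability guarantees that the \<open>LEAST\<close> in \<open>gdist\<close> is taken
  over a nonempty set, so that it is attained.\<close>

lemma gdist_relpow:
  assumes "u \<in> verts G" "(u, v) \<in> (adj G)\<^sup>*"
  shows "(u, v) \<in> adj G ^^ gdist G u v"
proof -
  obtain p where "path_between G u p v"
    using assms path_between_iff_rtrancl by metis
  then have "\<exists>n p. path_between G u p v \<and> n = length p - 1" by blast
  then have "\<exists>p. path_between G u p v \<and> gdist G u v = length p - 1"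
    unfolding gdist_def by (rule LeastI_ex)
  then show ?thesis using path_between_relpow by metis
qed

lemma gdist_self: "u \<in> verts G \<Longrightarrow> gdist G u u = 0"
  using gdist_le[of u G u 0] by simp

lemma path_between_rev: "path_between G u p v \<Longrightarrow> path_between G v (rev p) u"
  by (auto simp: path_between_def hd_rev last_rev insert_commute elim: successively_mono)

lemma gdist_commute: "gdist G u v = gdist G v u"
proof -
  have "(\<exists>p. path_between G u p v \<and> n = length p - 1) \<longleftrightarrow>
      (\<exists>p. path_between G v p u \<and> n = length p - 1)" for n
    by (metis path_between_rev length_rev)
  then show ?thesis by (simp add: gdist_def)
qed

section \<open>Distances between sets of vertices\<close>

lemma eedist_commute: "eedist G S T = eedist G T S"
proof -
  have "{gdist G x a |x a. x \<in> S \<and> a \<in> T} = {gdist G x a |x a. x \<in> T \<and> a \<in> S}"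
    using gdist_commute[of G] by (intro Collect_cong) metis
  then show ?thesis by (simp add: eedist_def)
qed

text \<open>Treating a vertex as a singleton makes all three distances instances of
  \<open>eedist\<close>. The image of an edge contracted in a quotient is exactly such a
  singleton.\<close>

lemma vedist_eq_eedist: "vedist G v T = eedist G {v} T"
  by (simp add: vedist_def eedist_def)

lemma gdist_eq_eedist: "gdist G u v = eedist G {u} {v}"
  by (simp add: eedist_def)

lemma eedist_le:
  assumes "finite S" "finite T" "x \<in> S" "a \<in> T"
  shows "eedist G S T \<le> gdist G x a"
proof -
  have "{gdist G x a |x a. x \<in> S \<and> a \<in> T} = (\<lambda>(x, a). gdist G x a) ` (S \<times> T)" by auto
  with assms have "finite {gdist G x a |x a. x \<in> S \<and> a \<in> T}" by simp
  then show ?thesis unfolding eedist_def using assms by (intro Min_le) auto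
qed

lemma eedist_attained:
  assumes "finite S" "finite T" "S \<noteq> {}" "T \<noteq> {}"
  obtains x a where "x \<in> S" "a \<in> T" "eedist G S T = gdist G x a"
proof -
  let ?D = "{gdist G x a |x a. x \<in> S \<and> a \<in> T}"
  have "?D = (\<lambda>(x, a). gdist G x a) ` (S \<times> T)" by auto
  with assms have "finite ?D" "?D \<noteq> {}" by auto
  then have "Min ?D \<in> ?D" by (rule Min_in)
  with that show thesis unfolding eedist_def by blast
qed

lemma edge_ends:
  assumes "finite_simple_graph G" "e \<in> edges G"
  obtains x y where "e = {x, y}" "x \<noteq> y" "x \<in> verts G" "y \<in> verts G"
proof -
  have "e \<subseteq> verts G" "card e = 2" using assms by (auto simp: finite_simple_graph_def)
  with that show thesis by (auto simp: card_2_iff)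
qed

lemma ThetaI:
  assumes "{x, y} \<in> edges G" "{a, b} \<in> edges G"
    and "gdist G x a + gdist G y b \<noteq> gdist G x b + gdist G y a"
  shows "({x, y}, {a, b}) \<in> Theta G"
  unfolding Theta_def using assms by blast

lemma finite_edges: "finite_simple_graph G \<Longrightarrow> finite (edges G)"
  by (rule finite_subset[of _ "Pow (verts G)"]) (auto simp: finite_simple_graph_def)

locale finite_connected_graph =
  fixes G :: "'a sgraph"
  assumes simple: "finite_simple_graph G"
    and connected: "connected_graph G"
begin

lemma adjI: "{x, y} \<in> edges G \<Longrightarrow> (x, y) \<in> adj G"
  using simple by (auto simp: finite_simple_graph_def adj_def)

lemma reachable: "u \<in> verts G \<Longrightarrow> v \<in> verts G \<Longrightarrow> (u, v) \<in> (adj G)\<^sup>*"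
  using connected path_between_iff_rtrancl by (fastforce simp: connected_graph_def)

lemma gdist_triangle:
  assumes "u \<in> verts G" "v \<in> verts G" "w \<in> verts G"
  shows "gdist G u w \<le> gdist G u v + gdist G v w"
proof -
  have "(u, w) \<in> adj G ^^ (gdist G u v + gdist G v w)"
    unfolding relpow_add using assms by (intro relcompI[where b = v] gdist_relpow reachable)
  then show ?thesis by (rule gdist_le[OF assms(1)])
qed

lemma gdist_edge_le:
  assumes "{x, y} \<in> edges G"
  shows "gdist G x y \<le> 1"
  using adjI[OF assms] by (intro gdist_le) (auto simp: adj_def)

lemma gdist_edge_lipschitz:
  assumes "{x, y} \<in> edges G" "z \<in> verts G"
  shows "int (gdist G z y) \<le> int (gdist G z x) + 1"
  using gdist_triangle[of z x y] gdist_edge_le[OF assms(1)] adjI[OF assms(1)] assms(2)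
  by (auto simp: adj_def)

text \<open>The first \<open>i\<close> steps and the remaining ones are walks that bound the
  distances to \<open>u\<close> and \<open>v\<close> from above; the triangle inequality forces
  equality in both bounds.\<close>

lemma geodesic:
  assumes "u \<in> verts G" "v \<in> verts G"
  obtains s where "s 0 = u" "s (gdist G u v) = v"
    "\<And>i. i < gdist G u v \<Longrightarrow> (s i, s (Suc i)) \<in> adj G"
    "\<And>i. i \<le> gdist G u v \<Longrightarrow> gdist G (s i) u = i"
    "\<And>i. i \<le> gdist G u v \<Longrightarrow> gdist G (s i) v = gdist G u v - i"
proof -
  let ?n = "gdist G u v"
  have "(u, v) \<in> adj G ^^ ?n" using assms by (intro gdist_relpow reachable)
  then obtain s where s: "s 0 = u" "s ?n = v" "\<And>i. i < ?n \<Longrightarrow> (s i, s (Suc i)) \<in> adj G"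
    unfolding relpow_fun_conv by blast
  have sub: "(s i, s (i + k)) \<in> adj G ^^ k" if "i + k \<le> ?n" for i k
    unfolding relpow_fun_conv using s(3) that
    by (intro exI[of _ "\<lambda>j. s (i + j)"]) simp
  have V: "s i \<in> verts G" if "i \<le> ?n" for i
    using sub[of 0 i] that assms(1) s(1) relpow_adj_verts by auto
  have "gdist G u (s i) = i \<and> gdist G (s i) v = ?n - i" if i: "i \<le> ?n" for i
  proof -
    have "gdist G u (s i) \<le> i" using gdist_le[OF assms(1), of "s i" i] sub[of 0 i] i s(1) by simp
    moreover have "gdist G (s i) v \<le> ?n - i"
      using gdist_le[OF V[OF i], of v "?n - i"] sub[of i "?n - i"] i s(2) by simp
    moreover have "?n \<le> gdist G u (s i) + gdist G (s i) v"
      using gdist_triangle[OF assms(1) V[OF i] assms(2)] .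
    ultimately show ?thesis using i by linarith
  qed
  then show thesis using that s gdist_commute by metis
qed

end


section \<open>Quotients by a union of classes\<close>

text \<open>Since \<open>Theta\<close> is symmetric, closure under a single step makes
  \<open>F\<close> a union of \<open>Theta_star\<close> classes.\<close>

locale theta_closed = finite_connected_graph +
  fixes F :: "'a set set"
  assumes F_subset: "F \<subseteq> edges G"
    and F_closed: "e \<in> F \<Longrightarrow> (e, f) \<in> Theta G \<Longrightarrow> f \<in> F"
begin

abbreviation "Q \<equiv> quotient_graph G F"

abbreviation "R \<equiv> adj (delete_edges G F)"

definition proj :: "'a \<Rightarrow> 'a set" where
  "proj v = {w \<in> verts G. (v, w) \<in> R\<^sup>*}"

lemma verts_quotient: "verts Q = proj ` verts G"
  using path_between_iff_rtrancl[of _ "delete_edges G F"]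
  by (auto simp: quotient_graph_def components_def proj_def image_def delete_edges_def)

lemma proj_eq_iff: "u \<in> verts G \<Longrightarrow> v \<in> verts G \<Longrightarrow> proj u = proj v \<longleftrightarrow> (u, v) \<in> R\<^sup>*"
  unfolding proj_def using adj_rtrancl_commute[of u v] by (auto dest: rtrancl_trans)

lemma mem_proj_iff: "u \<in> verts G \<Longrightarrow> x \<in> proj u \<longleftrightarrow> x \<in> verts G \<and> proj x = proj u"
  using proj_eq_iff[of x u] adj_rtrancl_commute[of x u] by (auto simp: proj_def)

lemma proj_edge_outside: "{x, y} \<in> edges G - F \<Longrightarrow> proj x = proj y"
  using adjI by (subst proj_eq_iff) (auto simp: adj_def delete_edges_def intro!: r_into_rtrancl)

text \<open>A related pair with just one member in \<open>F\<close> would contradict the closure of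
  \<open>F\<close>, applied in the direction that starts from that member.\<close>

lemma Theta_complement:
  assumes "{x, y} \<in> edges G" "{a, b} \<in> edges G" "({x, y} \<in> F) \<noteq> ({a, b} \<in> F)"
  shows "gdist G x a + gdist G y b = gdist G x b + gdist G y a"
proof (rule ccontr)
  assume neq: "\<not> ?thesis"
  then have "({x, y}, {a, b}) \<in> Theta G" using assms by (intro ThetaI) auto
  moreover have "({a, b}, {x, y}) \<in> Theta G"
    using neq assms by (intro ThetaI) (simp_all add: gdist_commute[of G a] gdist_commute[of G b])
  ultimately show False using assms(3) F_closed by blast
qed

section \<open>The potential of a geodesic\<close>

lemma geodesic_potential:
  assumes uv: "u \<in> verts G" "v \<in> verts G"
    and s: "s 0 = u" "s (gdist G u v) = v"
      "\<And>i. i < gdist G u v \<Longrightarrow> (s i, s (Suc i)) \<in> adj G"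
      "\<And>i. i \<le> gdist G u v \<Longrightarrow> gdist G (s i) u = i"
      "\<And>i. i \<le> gdist G u v \<Longrightarrow> gdist G (s i) v = gdist G u v - i"
  shows "\<exists>g :: 'a \<Rightarrow> int.
    g v - g u = 2 * int (card {i. i < gdist G u v \<and> {s i, s (Suc i)} \<in> F}) \<and>
    (\<forall>a b. {a, b} \<in> edges G - F \<longrightarrow> g a = g b) \<and>
    (\<forall>a b. {a, b} \<in> F \<longrightarrow> g b - g a \<le> 2)"
proof (intro exI conjI allI impI)
  let ?n = "gdist G u v"
  define I where "I = {i. i < ?n \<and> {s i, s (Suc i)} \<in> F}"
  define \<phi> where "\<phi> i z = int (gdist G (s i) z) - int (gdist G (s (Suc i)) z)" for i z
  define g where "g z = (\<Sum>i\<in>I. \<phi> i z)" for z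
  have I: "I \<subseteq> {..<?n}" "finite I" by (auto simp: I_def)
  have E: "{s i, s (Suc i)} \<in> edges G" if "i < ?n" for i using s(3)[OF that] by (simp add: adj_def)
  have "g v - g u = (\<Sum>i\<in>I. \<phi> i v - \<phi> i u)" by (simp add: g_def sum_subtractf)
  \<comment> \<open>With \<open>n\<close> the length of the geodesic, \<open>\<phi> i v\<close> is
    \<open>(n - i) - (n - Suc i) = 1\<close> and \<open>\<phi> i u\<close> is
    \<open>i - Suc i = -1\<close>.\<close>
  also have "\<dots> = (\<Sum>i\<in>I. 2)"
    by (rule sum.cong) (auto simp: I_def \<phi>_def s(4,5))
  finally show "g v - g u = 2 * int (card {i. i < ?n \<and> {s i, s (Suc i)} \<in> F})"
    by (simp add: I_def)
  have eq: "\<phi> i a = \<phi> i b"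
    if "i < ?n" "{a, b} \<in> edges G" "({s i, s (Suc i)} \<in> F) \<noteq> ({a, b} \<in> F)" for i a b
    using Theta_complement[OF E[OF that(1)] that(2,3)] by (simp add: \<phi>_def)
  show "g a = g b" if "{a, b} \<in> edges G - F" for a b
    unfolding g_def using that by (intro sum.cong refl eq) (auto simp: I_def)
  show "g b - g a \<le> 2" if "{a, b} \<in> F" for a b
  proof -
    have ab: "{a, b} \<in> edges G" "{b, a} \<in> edges G"
      using that F_subset by (auto simp: insert_commute)
    have "g b - g a = (\<Sum>i\<in>I. \<phi> i b - \<phi> i a)" by (simp add: g_def sum_subtractf)
    \<comment> \<open>The added indices belong to edges of the geodesic outside \<open>F\<close>. As
      \<open>{a, b}\<close> is in \<open>F\<close>, their terms vanish by \<open>eq\<close>.\<close>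
    also have "\<dots> = (\<Sum>i<?n. \<phi> i b - \<phi> i a)"
      using I ab(1) that eq[of _ a b] by (intro sum.mono_neutral_left) (auto simp: I_def)
    also have "\<dots> = (\<Sum>i<?n. \<phi> i b) - (\<Sum>i<?n. \<phi> i a)" by (simp add: sum_subtractf)
    also have "\<dots> = (int (gdist G u b) - int (gdist G v b)) - (int (gdist G u a) - int (gdist G v a))"
      unfolding \<phi>_def
      using sum_lessThan_telescope'[of "\<lambda>i. int (gdist G (s i) b)" ?n]
        sum_lessThan_telescope'[of "\<lambda>i. int (gdist G (s i) a)" ?n] s(1,2) by simp
    \<comment> \<open>From \<open>a\<close> to \<open>b\<close> the distance from \<open>u\<close>
      grows by at most 1 and the distance from \<open>v\<close> drops by at most 1.\<close>
    also have "\<dots> \<le> 2"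
      using gdist_edge_lipschitz[OF ab(1) uv(1)] gdist_edge_lipschitz[OF ab(2) uv(2)] by simp
    finally show ?thesis .
  qed
qed

text \<open>A potential that does not change along edges outside \<open>F\<close> is constant on
  components, so it descends to the vertices of \<open>Q\<close>.\<close>

lemma potential_proj:
  fixes g :: "'a \<Rightarrow> int"
  assumes "\<And>a b. {a, b} \<in> edges G - F \<Longrightarrow> g a = g b" "x \<in> verts G" "y \<in> verts G" "proj x = proj y"
  shows "g x = g y"
proof -
  have "(x, y) \<in> R\<^sup>*" using assms proj_eq_iff by blast
  then show ?thesis
    by (induction rule: rtrancl_induct) (use assms(1) in \<open>auto simp: adj_def delete_edges_def\<close>)
qed

text \<open>The edge is itself a geodesic of length 1, so its potential differs by 2 at the two
  ends, whereas it would agree on a common component.\<close>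

lemma proj_edge_inside:
  assumes "{x, y} \<in> F" "x \<noteq> y"
  shows "proj x \<noteq> proj y"
proof
  assume eq: "proj x = proj y"
  have xy: "x \<in> verts G" "y \<in> verts G" using adjI assms F_subset by (auto simp: adj_def)
  obtain s where s: "s 0 = x" "s (gdist G x y) = y"
    "\<And>i. i < gdist G x y \<Longrightarrow> (s i, s (Suc i)) \<in> adj G"
    "\<And>i. i \<le> gdist G x y \<Longrightarrow> gdist G (s i) x = i"
    "\<And>i. i \<le> gdist G x y \<Longrightarrow> gdist G (s i) y = gdist G x y - i"
    using geodesic[OF xy] by metis
  have "gdist G x y \<noteq> 0" using s(1,2) assms(2) by metis
  then have one: "gdist G x y = 1" using gdist_edge_le[of x y] assms F_subset by auto
  obtain g :: "'a \<Rightarrow> int"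
    where g: "g y - g x = 2 * int (card {i. i < gdist G x y \<and> {s i, s (Suc i)} \<in> F})"
      "\<forall>a b. {a, b} \<in> edges G - F \<longrightarrow> g a = g b"
    using geodesic_potential[OF xy s] by blast
  have "{i. i < gdist G x y \<and> {s i, s (Suc i)} \<in> F} = {0}"
    using s(1,2) one assms(1) by auto
  with g(1) have "g y - g x = 2" by simp
  moreover have "g x = g y" using potential_proj[where g = g, OF g(2)[rule_format] xy eq] .
  ultimately show False by simp
qed

text \<open>An edge outside \<open>F\<close> stays within one component, and an edge of
  \<open>F\<close> always joins two different ones by \<open>proj_edge_inside\<close>.\<close>

lemma edges_quotient: "edges Q = (`) proj ` F"
proof -
  have "components (delete_edges G F) = proj ` verts G"
    using verts_quotient by (simp add: quotient_graph_def)
  then have edges: "edges Q = {{X, Y} | X Y. X \<in> proj ` verts G \<and> Y \<in> proj ` verts G \<and> X \<noteq> Y \<and>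
      (\<exists>x\<in>X. \<exists>y\<in>Y. {x, y} \<in> edges G)}"
    by (simp add: quotient_graph_def)
  show ?thesis
  proof (intro equalityI subsetI)
    fix S assume "S \<in> edges Q"
    then obtain X Y x y where S: "S = {X, Y}" "X \<in> proj ` verts G" "Y \<in> proj ` verts G" "X \<noteq> Y"
      "x \<in> X" "y \<in> Y" "{x, y} \<in> edges G"
      unfolding edges by blast
    then have XY: "X = proj x" "Y = proj y" using mem_proj_iff by auto
    with S have "{x, y} \<in> F" using proj_edge_outside by auto
    then show "S \<in> (`) proj ` F" using S(1) XY by (auto intro!: image_eqI[of _ _ "{x, y}"])
  next
    fix S assume "S \<in> (`) proj ` F"
    then obtain e where e: "e \<in> F" "S = proj ` e" by blast
    obtain x y where xy: "e = {x, y}" "x \<noteq> y" "x \<in> verts G" "y \<in> verts G"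
      using edge_ends[OF simple] e(1) F_subset by blast
    have "S = {proj x, proj y}" "proj x \<noteq> proj y" "x \<in> proj x" "y \<in> proj y" "{x, y} \<in> edges G"
      using e xy proj_edge_inside F_subset mem_proj_iff by auto
    with xy(3,4) show "S \<in> edges Q" unfolding edges by blast
  qed
qed

section \<open>Distances in the quotient\<close>

lemma proj_adj:
  assumes "{x, y} \<in> F"
  shows "(proj x, proj y) \<in> adj Q"
proof -
  have "x \<in> verts G" "y \<in> verts G" using adjI assms F_subset by (auto simp: adj_def)
  moreover have "{proj x, proj y} \<in> edges Q"
    unfolding edges_quotient using assms by (auto intro!: image_eqI[of _ _ "{x, y}"])
  ultimately show ?thesis by (simp add: adj_def verts_quotient)
qed

lemma proj_walk:
  assumes "\<And>i. i < n \<Longrightarrow> (s i, s (Suc i)) \<in> adj G"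
  shows "(proj (s 0), proj (s n)) \<in> adj Q ^^ card {i. i < n \<and> {s i, s (Suc i)} \<in> F}"
  using assms
proof (induction n)
  case 0
  then show ?case by simp
next
  case (Suc n)
  let ?I = "\<lambda>n. {i. i < n \<and> {s i, s (Suc i)} \<in> F}"
  have IH: "(proj (s 0), proj (s n)) \<in> adj Q ^^ card (?I n)" using Suc by simp
  have E: "{s n, s (Suc n)} \<in> edges G" using Suc.prems[of n] by (simp add: adj_def)
  show ?case
  proof (cases "{s n, s (Suc n)} \<in> F")
    case True
    then have "?I (Suc n) = insert n (?I n)" by (auto simp: less_Suc_eq)
    then have "card (?I (Suc n)) = Suc (card (?I n))" by simp
    then show ?thesis using IH proj_adj[OF True] by auto
  next
    case False
    then have "?I (Suc n) = ?I n" by (auto simp: less_Suc_eq)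
    then show ?thesis using IH proj_edge_outside[of "s n" "s (Suc n)"] E False by simp
  qed
qed

text \<open>Consecutive edges of a walk in \<open>Q\<close> lift to edges of \<open>F\<close> that
  need not share an end. Their ends in a common component have the same potential, which is why the
  induction ranges over every \<open>y\<close> that projects to \<open>Y\<close>.\<close>

lemma potential_quotient_lipschitz:
  fixes g :: "'a \<Rightarrow> int"
  assumes g: "\<And>a b. {a, b} \<in> edges G - F \<Longrightarrow> g a = g b" "\<And>a b. {a, b} \<in> F \<Longrightarrow> g b - g a \<le> 2"
    and x: "x \<in> verts G"
  shows "(proj x, Y) \<in> adj Q ^^ m \<Longrightarrow> y \<in> verts G \<Longrightarrow> proj y = Y \<Longrightarrow> g y - g x \<le> 2 * int m"
proof (induction m arbitrary: Y y)
  case 0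
  then show ?case using potential_proj[where g = g, OF g(1) x, where y = y] by auto
next
  case (Suc m)
  then obtain Z where Z: "(proj x, Z) \<in> adj Q ^^ m" "(Z, Y) \<in> adj Q" by auto
  then obtain e where e: "e \<in> F" "{Z, Y} = proj ` e" by (auto simp: adj_def edges_quotient)
  obtain a b where ab: "e = {a, b}" "a \<in> verts G" "b \<in> verts G"
    using edge_ends[OF simple] e(1) F_subset by blast
  \<comment> \<open>The equality of sets leaves open which of \<open>a\<close> and \<open>b\<close>
    lies over \<open>Z\<close>, so both orders must be available for \<open>c\<close> and
    \<open>d\<close>.\<close>
  then have "{b, a} \<in> F" using e(1) by (simp add: insert_commute)
  then obtain c d where cd: "{c, d} \<in> F" "Z = proj c" "Y = proj d" "c \<in> verts G" "d \<in> verts G"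
    using e ab by (fastforce simp: doubleton_eq_iff)
  have "g c - g x \<le> 2 * int m" using Suc.IH Z(1) cd by blast
  moreover have "g d - g c \<le> 2" using g(2) cd(1) by blast
  moreover have "g y = g d" using potential_proj[where g = g, OF g(1)] Suc.prems cd by metis
  ultimately show ?case by simp
qed

text \<open>The projected geodesic gives the upper bound. Conversely, the potential rises by
  \<open>2 * ?c\<close> from \<open>u\<close> to \<open>v\<close>, while a shortest walk in
  \<open>Q\<close> permits a rise of at most \<open>2 * ?d\<close>.\<close>

lemma gdist_quotient:
  assumes uv: "u \<in> verts G" "v \<in> verts G"
    and s: "s 0 = u" "s (gdist G u v) = v"
      "\<And>i. i < gdist G u v \<Longrightarrow> (s i, s (Suc i)) \<in> adj G"
      "\<And>i. i \<le> gdist G u v \<Longrightarrow> gdist G (s i) u = i"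
      "\<And>i. i \<le> gdist G u v \<Longrightarrow> gdist G (s i) v = gdist G u v - i"
  shows "gdist Q (proj u) (proj v) = card {i. i < gdist G u v \<and> {s i, s (Suc i)} \<in> F}" (is "?d = ?c")
proof (rule antisym)
  have walk: "(proj u, proj v) \<in> adj Q ^^ ?c"
    using proj_walk[of "gdist G u v" s] s(1-3) by simp
  have pu: "proj u \<in> verts Q" using uv by (simp add: verts_quotient)
  show "?d \<le> ?c" by (rule gdist_le[OF pu walk])
  have "(proj u, proj v) \<in> adj Q ^^ ?d"
    by (rule gdist_relpow[OF pu relpow_imp_rtrancl[OF walk]])
  moreover obtain g :: "'a \<Rightarrow> int" where g: "g v - g u = 2 * int ?c"
    "\<forall>a b. {a, b} \<in> edges G - F \<longrightarrow> g a = g b" "\<forall>a b. {a, b} \<in> F \<longrightarrow> g b - g a \<le> 2"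
    using geodesic_potential[OF uv s] by blast
  ultimately have "g v - g u \<le> 2 * int ?d"
    using potential_quotient_lipschitz[where g = g, OF g(2,3)[rule_format] uv(1)] uv(2) by blast
  with g(1) show "?c \<le> ?d" by simp
qed

section \<open>Weights of the quotient as sums over edges of \<open>G\<close>\<close>

lemma proj_image_outside:
  assumes "e \<in> edges G - F"
  shows "proj ` e = {X} \<longleftrightarrow> e \<subseteq> X \<and> X \<in> verts Q" and "\<exists>X\<in>verts Q. proj ` e = {X}"
proof -
  obtain x y where e: "e = {x, y}" "x \<in> verts G" "y \<in> verts G"
    using edge_ends[OF simple] assms by blast
  then have eq: "proj x = proj y" using assms proj_edge_outside by blast
  then show "\<exists>X\<in>verts Q. proj ` e = {X}" using e by (auto simp: verts_quotient)
  show "proj ` e = {X} \<longleftrightarrow> e \<subseteq> X \<and> X \<in> verts Q"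
    using e eq mem_proj_iff by (auto simp: verts_quotient)
qed

lemma quotient_vertex_weight_eq:
  assumes "X \<in> verts Q"
  shows "quotient_vertex_weight G F w X = (\<Sum>e | e \<in> edges G - F \<and> proj ` e = {X}. w e)"
proof -
  have "e \<in> edges (delete_edges G F) \<and> e \<subseteq> X \<longleftrightarrow> e \<in> edges G - F \<and> proj ` e = {X}" for e
    using proj_image_outside(1)[of e X] assms by (simp add: delete_edges_def) blast
  then show ?thesis by (simp add: quotient_vertex_weight_def)
qed

text \<open>The two components forming \<open>S\<close> are distinct, so an edge of \<open>G\<close>
  between them cannot lie outside \<open>F\<close>.\<close>

lemma quotient_edge_weight_eq:
  assumes "S \<in> edges Q"
  shows "quotient_edge_weight G w S = (\<Sum>e | e \<in> F \<and> proj ` e = S. w e)"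
  unfolding quotient_edge_weight_def
proof (intro sum.cong refl Collect_cong iffI)
  obtain f where f: "f \<in> F" "S = proj ` f" using assms edges_quotient by auto
  obtain p q where pq: "f = {p, q}" "p \<noteq> q" "p \<in> verts G" "q \<in> verts G"
    using edge_ends[OF simple] f(1) F_subset by blast
  then have neq: "proj p \<noteq> proj q" using f proj_edge_inside by blast
  fix e
  {
    assume "\<exists>X Y. S = {X, Y} \<and> e \<in> edges_between G X Y"
    then obtain X Y x y where S: "S = {X, Y}" "e \<in> edges G" "x \<in> X" "y \<in> Y" "e = {x, y}"
      by (auto simp: edges_between_def)
    have "X \<in> proj ` verts G" "Y \<in> proj ` verts G"
      using S(1) f pq by (auto simp: doubleton_eq_iff)
    then have XY: "X = proj x" "Y = proj y" using S(3,4) mem_proj_iff by auto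
    then have "proj x \<noteq> proj y" using S(1) f pq neq by (auto simp: doubleton_eq_iff)
    then show "e \<in> F \<and> proj ` e = S" using S XY proj_edge_outside by auto
  next
    assume e: "e \<in> F \<and> proj ` e = S"
    then obtain x y where xy: "e = {x, y}" "x \<in> verts G" "y \<in> verts G"
      using edge_ends[OF simple] F_subset by blast
    then have "S = {proj x, proj y}" "x \<in> proj x" "y \<in> proj y" using e mem_proj_iff by auto
    then show "\<exists>X Y. S = {X, Y} \<and> e \<in> edges_between G X Y"
      using e xy F_subset by (auto simp: edges_between_def)
  }
qed

lemma finite_verts_quotient: "finite (verts Q)"
  using simple by (simp add: verts_quotient finite_simple_graph_def)

lemma finite_edges_quotient: "finite (edges Q)"
  unfolding edges_quotient using finite_subset[OF F_subset finite_edges[OF simple]] by simp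

text \<open>Groups the contracted edges by their image. The function \<open>k\<close> takes sets of
  vertices of \<open>Q\<close>, so the same \<open>k\<close> can serve here and in
  \<open>sum_quotient_edges\<close>.\<close>

lemma sum_quotient_verts:
  "(\<Sum>X\<in>verts Q. quotient_vertex_weight G F w X * k {X}) = (\<Sum>e\<in>edges G - F. w e * k (proj ` e))"
proof -
  have inj: "inj_on (\<lambda>X. {X}) (verts Q)" by simp
  have "(\<Sum>e\<in>edges G - F. w e * k (proj ` e)) =
      (\<Sum>S\<in>(\<lambda>X. {X}) ` verts Q. \<Sum>e | e \<in> edges G - F \<and> proj ` e = S. w e * k (proj ` e))"
    using finite_edges[OF simple] finite_verts_quotient proj_image_outside(2)
    by (intro sum.group[symmetric]) (auto simp: image_iff)
  also have "\<dots> = (\<Sum>X\<in>verts Q. \<Sum>e | e \<in> edges G - F \<and> proj ` e = {X}. w e * k {X})"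
    by (subst sum.reindex[OF inj]) (auto intro!: sum.cong)
  also have "\<dots> = (\<Sum>X\<in>verts Q. quotient_vertex_weight G F w X * k {X})"
    by (simp only: quotient_vertex_weight_eq sum_distrib_right cong: sum.cong)
  finally show ?thesis ..
qed

lemma sum_quotient_edges:
  "(\<Sum>S\<in>edges Q. quotient_edge_weight G w S * k S) = (\<Sum>e\<in>F. w e * k (proj ` e))"
proof -
  have "(\<Sum>e\<in>F. w e * k (proj ` e)) =
      (\<Sum>S\<in>edges Q. \<Sum>e | e \<in> F \<and> proj ` e = S. w e * k (proj ` e))"
    using finite_subset[OF F_subset finite_edges[OF simple]] finite_edges_quotient
    by (intro sum.group[symmetric]) (auto simp: edges_quotient)
  also have "\<dots> = (\<Sum>S\<in>edges Q. \<Sum>e | e \<in> F \<and> proj ` e = S. w e * k S)"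
    by (auto intro!: sum.cong)
  also have "\<dots> = (\<Sum>S\<in>edges Q. quotient_edge_weight G w S * k S)"
    by (simp only: quotient_edge_weight_eq sum_distrib_right cong: sum.cong)
  finally show ?thesis ..
qed

text \<open>The three indices collect the pairs with both edges outside \<open>F\<close>, both in
  \<open>F\<close>, and one of each kind. Mixed pairs occur in two orders on the right, which
  matches the missing factor 1/2 in \<open>vertex_edge_wiener\<close>.\<close>

lemma quotient_wiener_sum:
  "wiener Q (quotient_vertex_weight G F w) + edge_wiener Q (quotient_edge_weight G w) +
     vertex_edge_wiener Q (quotient_vertex_weight G F w) (quotient_edge_weight G w) =
   1/2 * (\<Sum>e\<in>edges G. \<Sum>f\<in>edges G. w e * w f * real (eedist Q (proj ` e) (proj ` f)))"
proof -
  let ?wv = "quotient_vertex_weight G F w" and ?we = "quotient_edge_weight G w"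
  let ?A = "edges G - F"
  define t where "t e f = w e * w f * real (eedist Q (proj ` e) (proj ` f))" for e f
  have vv: "(\<Sum>X\<in>verts Q. \<Sum>Y\<in>verts Q. ?wv X * ?wv Y * real (gdist Q X Y)) = (\<Sum>e\<in>?A. \<Sum>f\<in>?A. t e f)"
  proof -
    have "(\<Sum>X\<in>verts Q. \<Sum>Y\<in>verts Q. ?wv X * ?wv Y * real (gdist Q X Y)) =
        (\<Sum>X\<in>verts Q. ?wv X * (\<Sum>Y\<in>verts Q. ?wv Y * real (eedist Q {X} {Y})))"
      by (simp add: gdist_eq_eedist sum_distrib_left mult.assoc)
    also have "\<dots> = (\<Sum>X\<in>verts Q. ?wv X * (\<Sum>f\<in>?A. w f * real (eedist Q {X} (proj ` f))))"
      by (subst sum_quotient_verts) (rule refl)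
    \<comment> \<open>Here \<open>k\<close> is the whole inner sum, as a function of the set
      \<open>{X}\<close>.\<close>
    also have "\<dots> = (\<Sum>e\<in>?A. w e * (\<Sum>f\<in>?A. w f * real (eedist Q (proj ` e) (proj ` f))))"
      by (rule sum_quotient_verts)
    finally show ?thesis by (simp add: t_def sum_distrib_left mult.assoc)
  qed
  have ee: "(\<Sum>S\<in>edges Q. \<Sum>T\<in>edges Q. ?we S * ?we T * real (eedist Q S T)) = (\<Sum>e\<in>F. \<Sum>f\<in>F. t e f)"
  proof -
    have "(\<Sum>S\<in>edges Q. \<Sum>T\<in>edges Q. ?we S * ?we T * real (eedist Q S T)) =
        (\<Sum>S\<in>edges Q. ?we S * (\<Sum>T\<in>edges Q. ?we T * real (eedist Q S T)))"
      by (simp add: sum_distrib_left mult.assoc)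
    also have "\<dots> = (\<Sum>S\<in>edges Q. ?we S * (\<Sum>f\<in>F. w f * real (eedist Q S (proj ` f))))"
      by (subst sum_quotient_edges) (rule refl)
    also have "\<dots> = (\<Sum>e\<in>F. w e * (\<Sum>f\<in>F. w f * real (eedist Q (proj ` e) (proj ` f))))"
      by (rule sum_quotient_edges)
    finally show ?thesis by (simp add: t_def sum_distrib_left mult.assoc)
  qed
  have ve: "(\<Sum>X\<in>verts Q. \<Sum>T\<in>edges Q. ?wv X * ?we T * real (vedist Q X T)) = (\<Sum>e\<in>?A. \<Sum>f\<in>F. t e f)"
  proof -
    have "(\<Sum>X\<in>verts Q. \<Sum>T\<in>edges Q. ?wv X * ?we T * real (vedist Q X T)) =
        (\<Sum>X\<in>verts Q. ?wv X * (\<Sum>T\<in>edges Q. ?we T * real (eedist Q {X} T)))"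
      by (simp add: vedist_eq_eedist sum_distrib_left mult.assoc)
    also have "\<dots> = (\<Sum>X\<in>verts Q. ?wv X * (\<Sum>f\<in>F. w f * real (eedist Q {X} (proj ` f))))"
      by (subst sum_quotient_edges) (rule refl)
    also have "\<dots> = (\<Sum>e\<in>?A. w e * (\<Sum>f\<in>F. w f * real (eedist Q (proj ` e) (proj ` f))))"
      by (rule sum_quotient_verts)
    finally show ?thesis by (simp add: t_def sum_distrib_left mult.assoc)
  qed
  have "t e f = t f e" for e f by (simp add: t_def eedist_commute)
  then have ev: "(\<Sum>e\<in>F. \<Sum>f\<in>?A. t e f) = (\<Sum>e\<in>?A. \<Sum>f\<in>F. t e f)"
    by (subst sum.swap) simp
  have "(\<Sum>e\<in>edges G. h e) = (\<Sum>e\<in>?A. h e) + (\<Sum>e\<in>F. h e)" for h :: "'a set \<Rightarrow> real"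
    by (rule sum.subset_diff[OF F_subset finite_edges[OF simple]])
  then have "(\<Sum>e\<in>edges G. \<Sum>f\<in>edges G. t e f) =
      (\<Sum>e\<in>?A. \<Sum>f\<in>?A. t e f) + 2 * (\<Sum>e\<in>?A. \<Sum>f\<in>F. t e f) + (\<Sum>e\<in>F. \<Sum>f\<in>F. t e f)"
    using ev by (simp add: sum.distrib)
  then show ?thesis
    by (simp add: wiener_def edge_wiener_def vertex_edge_wiener_def vv ee ve t_def)
qed

end


section \<open>Summing over a c-partition\<close>

text \<open>\<open>Theta_star\<close> is only a transitive closure; this puts every edge into its
  own class.\<close>

lemma Theta_refl:
  assumes "finite_simple_graph G" "connected_graph G" "e \<in> edges G"
  shows "(e, e) \<in> Theta G"
proof -
  interpret finite_connected_graph G using assms by unfold_locales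
  obtain x y where e: "e = {x, y}" "x \<noteq> y" "x \<in> verts G" "y \<in> verts G"
    using edge_ends[OF assms(1,3)] .
  obtain s where "s 0 = x" "s (gdist G x y) = y" using geodesic[OF e(3,4)] by metis
  then have "gdist G x y \<noteq> 0" using e(2) by metis
  then have "gdist G x x + gdist G y y \<noteq> gdist G x y + gdist G y x"
    using gdist_self[OF e(3)] gdist_self[OF e(4)] by simp
  then show ?thesis using assms(3) unfolding e(1) by (intro ThetaI)
qed

text \<open>The block containing the class of \<open>e\<close> contains \<open>e\<close> itself by
  \<open>Theta_refl\<close>, so disjointness identifies it with \<open>F\<close>.\<close>

lemma c_partition_theta_closed:
  assumes "finite_simple_graph G" "connected_graph G" "c_partition G P" "F \<in> P"
  shows "theta_closed G F"
proof unfold_locales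
  have P: "partition_on (edges G) P" "\<And>C. C \<in> edges G // Theta_star G \<Longrightarrow> \<exists>F\<in>P. C \<subseteq> F"
    using assms(3) by (auto simp: c_partition_def)
  show sub: "F \<subseteq> edges G" using P(1) assms(4) by (auto simp: partition_on_def)
  fix e f assume ef: "e \<in> F" "(e, f) \<in> Theta G"
  have "Theta_star G `` {e} \<in> edges G // Theta_star G" using ef(1) sub by (auto intro: quotientI)
  then obtain F' where F': "F' \<in> P" "Theta_star G `` {e} \<subseteq> F'" using P(2) by blast
  have "e \<in> F'" "f \<in> F'"
    using F'(2) ef Theta_refl[OF assms(1,2)] sub unfolding Theta_star_def by auto
  moreover have "F' = F"
    using partition_onD2[OF P(1)] F'(1) assms(4) ef(1) \<open>e \<in> F'\<close> by (auto simp: disjoint_def)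
  ultimately show "f \<in> F" by simp
qed (use assms in auto)

text \<open>One geodesic serves all quotients: each of its edges lies in exactly one block and is
  counted only in the corresponding quotient.\<close>

lemma gdist_eq_sum_quotients:
  assumes G: "finite_simple_graph G" "connected_graph G" and P: "c_partition G P"
    and uv: "u \<in> verts G" "v \<in> verts G"
  shows "gdist G u v =
    (\<Sum>F\<in>P. gdist (quotient_graph G F) (theta_closed.proj G F u) (theta_closed.proj G F v))"
proof -
  interpret finite_connected_graph G using G by unfold_locales
  let ?n = "gdist G u v"
  have part: "partition_on (edges G) P" using P by (simp add: c_partition_def)
  obtain s where s: "s 0 = u" "s ?n = v" "\<And>i. i < ?n \<Longrightarrow> (s i, s (Suc i)) \<in> adj G"
    "\<And>i. i \<le> ?n \<Longrightarrow> gdist G (s i) u = i" "\<And>i. i \<le> ?n \<Longrightarrow> gdist G (s i) v = ?n - i"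
    using geodesic[OF uv] by metis
  let ?I = "\<lambda>F. {i. i < ?n \<and> {s i, s (Suc i)} \<in> F}"
  have "(\<Sum>F\<in>P. gdist (quotient_graph G F) (theta_closed.proj G F u) (theta_closed.proj G F v)) =
      (\<Sum>F\<in>P. card (?I F))"
    by (intro sum.cong refl
        theta_closed.gdist_quotient[OF c_partition_theta_closed[OF G P] uv s])
  also have "\<dots> = card (\<Union>F\<in>P. ?I F)"
    using partition_onD2[OF part] finite_elements[OF finite_edges[OF G(1)] part]
    by (subst card_UN_disjoint) (auto simp: disjoint_def)
  also have "(\<Union>F\<in>P. ?I F) = {..<?n}"
    using s(3) partition_onD1[OF part] by (fastforce simp: adj_def)
  finally show ?thesis by simp
qed

text \<open>The minimum of a sum is at least the sum of the minima; equality requires one pair of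
  ends that attains the minimum in every quotient.\<close>

lemma eedist_eq_sum_quotients:
  assumes G: "finite_simple_graph G" "connected_graph G" and P: "c_partition G P"
    and ef: "e \<in> edges G" "f \<in> edges G"
  shows "eedist G e f =
    (\<Sum>F\<in>P. eedist (quotient_graph G F) (theta_closed.proj G F ` e) (theta_closed.proj G F ` f))"
proof -
  define pr where "pr = theta_closed.proj G"
  define D where "D F x a = gdist (quotient_graph G F) (pr F x) (pr F a)" for F x a
  define M where "M F = eedist (quotient_graph G F) (pr F ` e) (pr F ` f)" for F
  have part: "partition_on (edges G) P" using P by (simp add: c_partition_def)
  have fin: "finite e" "finite f" "e \<noteq> {}" "f \<noteq> {}" and V: "e \<subseteq> verts G" "f \<subseteq> verts G"
    using edge_ends[OF G(1) ef(1)] edge_ends[OF G(1) ef(2)] by auto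
  have sum: "gdist G x a = (\<Sum>F\<in>P. D F x a)" if "x \<in> e" "a \<in> f" for x a
    unfolding D_def pr_def using that V by (intro gdist_eq_sum_quotients[OF G P]) auto
  have M_le: "M F \<le> D F x a" if "x \<in> e" "a \<in> f" for F x a
    unfolding M_def D_def using that fin by (intro eedist_le) auto
  have M_att: "\<exists>x\<in>e. \<exists>a\<in>f. M F = D F x a" for F
  proof -
    obtain X A where "X \<in> pr F ` e" "A \<in> pr F ` f" "M F = gdist (quotient_graph G F) X A"
      using eedist_attained[of "pr F ` e" "pr F ` f" "quotient_graph G F"] fin
      unfolding M_def by blast
    then show ?thesis unfolding D_def by blast
  qed
  have const: "pr F x = pr F y" if h: "F \<in> P" "h \<in> edges G - F" "x \<in> h" "y \<in> h" for F h x y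
  proof -
    interpret theta_closed G F by (rule c_partition_theta_closed[OF G P h(1)])
    obtain X where "proj ` h = {X}" using proj_image_outside(2)[OF h(2)] by blast
    then show ?thesis using h(3,4) unfolding pr_def by blast
  qed
  obtain Fe Ff where FF: "Fe \<in> P" "e \<in> Fe" "Ff \<in> P" "f \<in> Ff"
    using ef partition_onD1[OF part] by auto
  have uniq: "F = F'" if "F \<in> P" "F' \<in> P" "h \<in> F" "h \<in> F'" for F F' h
    using partition_onD2[OF part] that by (auto simp: disjoint_def)
  obtain x0 a0 where 0: "x0 \<in> e" "a0 \<in> f" "M Fe = D Fe x0 a0" using M_att by blast
  obtain x1 a1 where 1: "x1 \<in> e" "a1 \<in> f" "M Ff = D Ff x1 a1" using M_att by blast
  \<comment> \<open>The ends of \<open>e\<close> only differ in \<open>G/Fe\<close> and those of \<open>f\<close> only in \<open>G/Ff\<close>, so that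
    the distances in all quotients can be minimised simultaneously.\<close>
  have "\<exists>x\<in>e. \<exists>a\<in>f. \<forall>F\<in>P. D F x a = M F"
  proof (cases "Fe = Ff")
    case True
    have "D F x0 a0 = M F" if F: "F \<in> P" for F
    proof (cases "F = Fe")
      case False
      then have "e \<notin> F" "f \<notin> F" using uniq FF F True by blast+
      \<comment> \<open>Both edges are contracted in this quotient, so every choice of ends gives
        the same distance.\<close>
      then show ?thesis using M_att[of F] const[OF F] ef 0 unfolding D_def by (metis DiffI)
    qed (use 0 in simp)
    with 0 show ?thesis by blast
  next
    case False
    \<comment> \<open>The end \<open>x0\<close> is optimal for \<open>Fe\<close> and
      \<open>a1\<close> for \<open>Ff\<close>. In \<open>Fe\<close> the edge \<open>f\<close> is
      contracted, so \<open>a1\<close> may replace \<open>a0\<close>; in \<open>Ff\<close> likewise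
      \<open>x0\<close> may replace \<open>x1\<close>.\<close>
    have "D F x0 a1 = M F" if F: "F \<in> P" for F
    proof -
      consider "F = Fe" "f \<notin> F" | "F = Ff" "e \<notin> F" | "e \<notin> F" "f \<notin> F"
        using uniq FF F False by blast
      then show ?thesis
      proof cases
        case 1
        then have "pr F a1 = pr F a0" using const[OF F, of f] ef \<open>a1 \<in> f\<close> 0 by blast
        then show ?thesis using 1 0 unfolding D_def by simp
      next
        case 2
        then have "pr F x0 = pr F x1" using const[OF F, of e] ef \<open>x1 \<in> e\<close> 0 by blast
        then show ?thesis using 2 \<open>M Ff = D Ff x1 a1\<close> unfolding D_def by simp
      next
        case 3
        then show ?thesis using M_att[of F] const[OF F] ef 0 \<open>a1 \<in> f\<close> unfolding D_def by (metis DiffI)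
      qed
    qed
    with 0 1 show ?thesis by blast
  qed
  then obtain x a where xa: "x \<in> e" "a \<in> f" "\<forall>F\<in>P. D F x a = M F" by blast
  have "eedist G e f = (\<Sum>F\<in>P. M F)"
  proof (rule antisym)
    show "eedist G e f \<le> (\<Sum>F\<in>P. M F)"
      using eedist_le[OF fin(1,2) xa(1,2), of G] sum[OF xa(1,2)] xa(3) by simp
    obtain y b where "y \<in> e" "b \<in> f" "eedist G e f = gdist G y b"
      using eedist_attained[OF fin] by blast
    then show "(\<Sum>F\<in>P. M F) \<le> eedist G e f" using sum M_le by (simp add: sum_mono)
  qed
  then show ?thesis by (simp add: M_def pr_def)
qed

theorem theorem3p3:
  fixes G :: "'a sgraph" and we :: "'a set \<Rightarrow> real" and P :: "'a set set set"
  assumes "finite_simple_graph G"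
    and "connected_graph G"
    and "\<forall>e\<in>edges G. 0 \<le> we e"
    and "c_partition G P"
  shows "edge_wiener G we =
    (\<Sum>F\<in>P.
        wiener (quotient_graph G F) (quotient_vertex_weight G F we)
      + edge_wiener (quotient_graph G F) (quotient_edge_weight G we)
      + vertex_edge_wiener (quotient_graph G F)
          (quotient_vertex_weight G F we) (quotient_edge_weight G we))"
proof -
  define d where "d F e f =
    real (eedist (quotient_graph G F) (theta_closed.proj G F ` e) (theta_closed.proj G F ` f))" for F e f
  have "edge_wiener G we = 1/2 * (\<Sum>e\<in>edges G. \<Sum>f\<in>edges G. we e * we f * (\<Sum>F\<in>P. d F e f))"
    unfolding edge_wiener_def d_def
    using eedist_eq_sum_quotients[OF assms(1,2,4)] by simp
  \<comment> \<open>The sum over the blocks moves outwards past one edge sum at a time.\<close>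
  also have "\<dots> = 1/2 * (\<Sum>e\<in>edges G. \<Sum>F\<in>P. \<Sum>f\<in>edges G. we e * we f * d F e f)"
    unfolding sum_distrib_left by (subst (2) sum.swap) (rule refl)
  also have "\<dots> = (\<Sum>F\<in>P. 1/2 * (\<Sum>e\<in>edges G. \<Sum>f\<in>edges G. we e * we f * d F e f))"
    unfolding sum_distrib_left by (subst sum.swap) (rule refl)
  finally show ?thesis
    unfolding d_def
    by (simp only: theta_closed.quotient_wiener_sum[OF c_partition_theta_closed[OF assms(1,2,4)]]
        cong: sum.cong)
qed

end
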